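(* Let $V$ be a Hilbert space with a localizing space decomposition with local spaces $V_1,\dots,V_N$ and mappings $\mathcal{P}_{V_i}:V\to V_i$. Let $a$ be a continuous, symmetric and coercive form on $V$, let $V$ be equipped with the energy norm $\|\cdot\|_a$ induced by $a$, let $f\in V'$, and let $u\in V$ solve $a(u,v)=f(v)$ for all $v\in V$. Construct $\widetilde V_n$ and $\widetilde u_n$ by residual based online enrichment: $\widetilde V_0:=\{0\}$; for $n=0,1,2,\dots$ let $\widetilde u_n\in\widetilde V_n$ solve $a(\widetilde u_n,\varphi)=f(\varphi)$ for all $\varphi\in\widetilde V_n$; let $\mathcal{R}(\widetilde u_n)(\cdot):=f(\cdot)-a(\widetilde u_n,\cdot)$; choose $k\in\operatorname{arg\,max}_{i=1,\dots,N}\|\mathcal{R}(\widetilde u_n)\|_{V_i'}$; let $\widehat u_n\in V_k$ solve $a(\widehat u_n,\varphi)=\mathcal{R}(\widetilde u_n)(\varphi)$ for all $\varphi\in V_k$; and set $\widetilde V_{n+1}:=\widetilde V_n+\operatorname{span}\{\widehat u_n\}$. Then, for every $n$ at which the iteration has not yet converged ($\widetilde u_n\neq u$), $$\|u-\widetilde u_{n+1}\|_a\le c_{\mathrm{rbe}}\cdot\|u-\widetilde u_n\|_a,\qquad c_{\mathrm{rbe}}:=\sqrt{1-\frac1N\,\frac{1}{c_{\mathrm{pu},\widetilde V}^2}},$$ where $\widetilde V=\widetilde V_n$ and $$c_{\mathrm{pu},\widetilde V}:=\sup_{\varphi\in V\setminus\{0\}}\frac{\big(\sum_{i=1}^N\|(1-P_{\widetilde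 V\cap V_i})\mathcal{P}_{V_i}(\varphi)\|_a^2\big)^{1/2}}{\|\varphi\|_a},$$ with $P_{\widetilde V\cap V_i}$ the orthogonal projection onto $\widetilde V\cap V_i$ in the energy inner product.
   Context: A localizing space decomposition consists of: an open, bounded, connected domain $\Omega\subset\mathbb{R}^d$ with smooth boundary; a Hilbert space $V$ of functions on $\Omega$ (over $\mathbb{R}$ or $\mathbb{C}$); subdomains $\omega_1,\dots,\omega_N$ forming an overlapping or non-overlapping domain decomposition of $\Omega$; (closed) subspaces $V_1,\dots,V_N\subseteq V$ with $\sum_i V_i=V$ and $\operatorname{supp}\varphi\subseteq\omega_i$ for all $\varphi\in V_i$; and linear maps $\mathcal{P}_{V_i}:V\to V_i$ with $\sum_i\mathcal{P}_{V_i}(\varphi)=\varphi$ for all $\varphi\in V$. The form $a$ is bilinear, symmetric (in the complex case sesquilinear, Hermitian), and $\|\varphi\|_a^2=a(\varphi,\varphi)$. Dual norms use the energy norm: $\|F\|_{V_i'}:=\sup_{\varphi\in V_i\setminus\{0\}}|F(\varphi)|/\|\varphi\|_a$. Constants defined as suprema may be $+\infty$, with $1/\infty=0$. *)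

theory Defs
  imports "HOL-Analysis.Analysis"
begin

text \<open>
  Real and complex scalars are treated together. A field whose norm is multiplicative and which
  contains the reals is a copy of the reals or of the complex numbers, where the last axiom then
  determines \<open>conj\<close>; so the two instances below are, up to isomorphism, the only ones.
\<close>

class real_or_complex = real_normed_field +
  fixes conj :: "'a \<Rightarrow> 'a"
    and re :: "'a \<Rightarrow> real"
  assumes conj_add: "conj (x + y) = conj x + conj y"
    and conj_mult: "conj (x * y) = conj x * conj y"
    and conj_conj: "conj (conj x) = x"
    and scaleR_re: "re x *\<^sub>R 1 = (x + conj x) / 2"
    and mult_conj: "x * conj x = (norm x)\<^sup>2 *\<^sub>R 1"

instantiation real :: real_or_complex
begin
definition conj_real :: "real \<Rightarrow> real" where "conj_real x = x"
definition re_real :: "real \<Rightarrow> real" where "re_real x = x"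
instance
  by standard (simp_all add: conj_real_def re_real_def power2_eq_square)
end

instantiation complex :: real_or_complex
begin
definition conj_complex :: "complex \<Rightarrow> complex" where "conj_complex = cnj"
definition re_complex :: "complex \<Rightarrow> real" where "re_complex = Re"
instance
  by standard
    (simp_all add: conj_complex_def re_complex_def complex_eq_iff cmod_power2
      power2_eq_square[of "Re _"] power2_eq_square[of "Im _"])
end


subsection \<open>Domains\<close>

text \<open>Continuous differentiability of order \<open>k\<close>; intended for open \<open>U\<close> only.\<close>

primrec C_k_on :: "nat \<Rightarrow> 'a::euclidean_space set \<Rightarrow> ('a \<Rightarrow> real) \<Rightarrow> bool" where
  "C_k_on 0 U g \<longleftrightarrow> continuous_on U g"
| "C_k_on (Suc k) U g \<longleftrightarrow>
     g differentiable_on U \<and>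
     (\<forall>b\<in>Basis. C_k_on k U (\<lambda>x. frechet_derivative g (at x) b))"

definition smooth_on :: "'a::euclidean_space set \<Rightarrow> ('a \<Rightarrow> real) \<Rightarrow> bool" where
  "smooth_on U g \<longleftrightarrow> (\<forall>k. C_k_on k U g)"

text \<open>Near each boundary point, \<open>\<Omega>\<close> is the sublevel set of a smooth function with nonvanishing
  gradient; by the implicit function theorem, \<open>\<Omega>\<close> then lies locally on one side of a smooth
  graph.\<close>

definition smooth_boundary :: "'a::euclidean_space set \<Rightarrow> bool" where
  "smooth_boundary \<Omega> \<longleftrightarrow>
     (\<forall>p\<in>frontier \<Omega>. \<exists>U \<rho>. open U \<and> p \<in> U \<and> smooth_on U \<rho> \<and>
        (\<forall>x\<in>U. frechet_derivative \<rho> (at x) \<noteq> (\<lambda>_. 0)) \<and>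
        \<Omega> \<inter> U = {x \<in> U. \<rho> x < 0} \<and>
        frontier \<Omega> \<inter> U = {x \<in> U. \<rho> x = 0})"

text \<open>A subdomain may or may not contain parts of its boundary: both conventions are in use, open
  sets for overlapping and closed cells for non-overlapping decompositions.\<close>

definition subdomain :: "'a::euclidean_space set \<Rightarrow> 'a set \<Rightarrow> bool" where
  "subdomain \<Omega> D \<longleftrightarrow> D \<noteq> {} \<and> D \<subseteq> closure \<Omega> \<and> D \<subseteq> closure (interior D)"

definition overlapping_decomposition ::
    "'a::euclidean_space set \<Rightarrow> nat \<Rightarrow> (nat \<Rightarrow> 'a set) \<Rightarrow> bool" where
  "overlapping_decomposition \<Omega> N \<omega> \<longleftrightarrow>
     (\<forall>i\<in>{1..N}. subdomain \<Omega> (\<omega> i)) \<and> \<Omega> \<subseteq> (\<Union>i\<in>{1..N}. interior (\<omega> i))"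

definition nonoverlapping_decomposition ::
    "'a::euclidean_space set \<Rightarrow> nat \<Rightarrow> (nat \<Rightarrow> 'a set) \<Rightarrow> bool" where
  "nonoverlapping_decomposition \<Omega> N \<omega> \<longleftrightarrow>
     (\<forall>i\<in>{1..N}. subdomain \<Omega> (\<omega> i)) \<and>
     (\<forall>i\<in>{1..N}. \<forall>j\<in>{1..N}. i \<noteq> j \<longrightarrow> interior (\<omega> i) \<inter> interior (\<omega> j) = {}) \<and>
     \<Omega> \<subseteq> (\<Union>i\<in>{1..N}. closure (\<omega> i))"

text \<open>The support, relatively closed in the open set \<open>\<Omega>\<close>, of a function on \<open>\<Omega>\<close> that is given up to
  equality almost everywhere. For continuous functions it is the closure in \<open>\<Omega>\<close> of the set of
  points where the function does not vanish.\<close>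

definition ess_supp :: "'a::euclidean_space set \<Rightarrow> ('a \<Rightarrow> 'k::zero) \<Rightarrow> 'a set" where
  "ess_supp \<Omega> g = {x \<in> \<Omega>. \<forall>U. open U \<and> x \<in> U \<longrightarrow> \<not> (AE y in lebesgue_on (\<Omega> \<inter> U). g y = 0)}"


subsection \<open>Hilbert spaces of functions\<close>

text \<open>Forms are linear in the second argument (and hence antilinear in the first), so that
  \<open>a(u, \<cdot>)\<close> is a linear functional, as is required by \<open>a(u, \<cdot>) = f\<close> with \<open>f\<close> in the dual space.\<close>

definition hermitian_form ::
    "('k::real_or_complex \<Rightarrow> 'v::ab_group_add \<Rightarrow> 'v) \<Rightarrow> ('v \<Rightarrow> 'v \<Rightarrow> 'k) \<Rightarrow> bool" where
  "hermitian_form smul h \<longleftrightarrow>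
     (\<forall>x. Vector_Spaces.linear smul (*) (h x)) \<and> (\<forall>x y. h y x = conj (h x y))"

text \<open>A Hilbert space over \<open>'k\<close> is a Banach space whose norm is induced by an inner product.\<close>

locale hilbert_space = vector_space smul
  for smul :: "'k::real_or_complex \<Rightarrow> 'v::banach \<Rightarrow> 'v" +
  fixes ip :: "'v \<Rightarrow> 'v \<Rightarrow> 'k"
  assumes smul_of_real: "smul (of_real r) x = r *\<^sub>R x"
    and hermitian_ip: "hermitian_form smul ip"
    and ip_self: "ip x x = of_real ((norm x)\<^sup>2)"

text \<open>
  The elements of the Hilbert space are functions on \<open>\<Omega>\<close> identified when equal almost everywhere,
  as in Lebesgue and Sobolev spaces: \<open>fn v\<close> is a representative of the element \<open>v\<close>, whose values
  outside \<open>\<Omega>\<close> are irrelevant.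
\<close>

locale hilbert_function_space = hilbert_space smul ip
  for smul :: "'k::real_or_complex \<Rightarrow> 'v::banach \<Rightarrow> 'v" and ip :: "'v \<Rightarrow> 'v \<Rightarrow> 'k" +
  fixes \<Omega> :: "(real ^ 'd) set"
    and fn :: "'v \<Rightarrow> real ^ 'd \<Rightarrow> 'k"
  assumes fn_add: "AE x in lebesgue_on \<Omega>. fn (v + w) x = fn v x + fn w x"
    and fn_smul: "AE x in lebesgue_on \<Omega>. fn (smul c v) x = c * fn v x"
    and fn_inj: "(AE x in lebesgue_on \<Omega>. fn v x = fn w x) \<Longrightarrow> v = w"

locale localizing_space_decomposition = hilbert_function_space smul ip \<Omega> fn
  for smul :: "'k::real_or_complex \<Rightarrow> 'v::banach \<Rightarrow> 'v" and ip :: "'v \<Rightarrow> 'v \<Rightarrow> 'k"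
    and \<Omega> :: "(real ^ 'd) set" and fn :: "'v \<Rightarrow> real ^ 'd \<Rightarrow> 'k" +
  fixes N :: nat
    and \<omega> :: "nat \<Rightarrow> (real ^ 'd) set"
    and V :: "nat \<Rightarrow> 'v set"
    and P :: "nat \<Rightarrow> 'v \<Rightarrow> 'v"
  assumes domain: "open \<Omega>" "bounded \<Omega>" "connected \<Omega>" "\<Omega> \<noteq> {}" "smooth_boundary \<Omega>"
    and decomposition:
      "overlapping_decomposition \<Omega> N \<omega> \<or> nonoverlapping_decomposition \<Omega> N \<omega>"
    and local_subspace: "i \<in> {1..N} \<Longrightarrow> subspace (V i)"
    and local_closed: "i \<in> {1..N} \<Longrightarrow> closed (V i)"
    and sum_local_spaces: "\<exists>w. (\<forall>i\<in>{1..N}. w i \<in> V i) \<and> v = (\<Sum>i = 1..N. w i)"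
    and local_supp: "i \<in> {1..N} \<Longrightarrow> v \<in> V i \<Longrightarrow> ess_supp \<Omega> (fn v) \<subseteq> \<omega> i"
    and P_linear: "i \<in> {1..N} \<Longrightarrow> Vector_Spaces.linear smul smul (P i)"
    and P_range: "i \<in> {1..N} \<Longrightarrow> P i v \<in> V i"
    and P_sum: "(\<Sum>i = 1..N. P i v) = v"


subsection \<open>Energy norm, dual norms and projections\<close>

definition continuous_form :: "('v::real_normed_vector \<Rightarrow> 'v \<Rightarrow> 'k::real_or_complex) \<Rightarrow> bool" where
  "continuous_form a \<longleftrightarrow> (\<exists>C. \<forall>x y. norm (a x y) \<le> C * norm x * norm y)"

definition coercive_form :: "('v::real_normed_vector \<Rightarrow> 'v \<Rightarrow> 'k::real_or_complex) \<Rightarrow> bool" where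
  "coercive_form a \<longleftrightarrow> (\<exists>\<alpha>>0. \<forall>x. \<alpha> * (norm x)\<^sup>2 \<le> re (a x x))"

definition energy_norm :: "('v \<Rightarrow> 'v \<Rightarrow> 'k::real_or_complex) \<Rightarrow> 'v \<Rightarrow> real" where
  "energy_norm a x = sqrt (re (a x x))"

text \<open>A supremum in the extended nonnegative reals; it is \<open>0\<close> if \<open>W = {0}\<close>.\<close>

definition dual_norm ::
    "('v::zero \<Rightarrow> 'v \<Rightarrow> 'k::real_or_complex) \<Rightarrow> 'v set \<Rightarrow> ('v \<Rightarrow> 'k) \<Rightarrow> ennreal" where
  "dual_norm a W F = (SUP \<phi>\<in>W - {0}. ennreal (norm (F \<phi>) / energy_norm a \<phi>))"

definition energy_projection ::
    "('v::minus \<Rightarrow> 'v \<Rightarrow> 'k::real_or_complex) \<Rightarrow> 'v set \<Rightarrow> 'v \<Rightarrow> 'v" where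
  "energy_projection a W x = (THE p. p \<in> W \<and> (\<forall>w\<in>W. a w (x - p) = 0))"

definition c_pu ::
    "('v::ab_group_add \<Rightarrow> 'v \<Rightarrow> 'k::real_or_complex) \<Rightarrow> nat \<Rightarrow> (nat \<Rightarrow> 'v set) \<Rightarrow>
     (nat \<Rightarrow> 'v \<Rightarrow> 'v) \<Rightarrow> 'v set \<Rightarrow> ennreal" where
  "c_pu a N V P W =
     (SUP \<phi>\<in>UNIV - {0}. ennreal
        (sqrt (\<Sum>i = 1..N. (energy_norm a (P i \<phi> - energy_projection a (W \<inter> V i) (P i \<phi>)))\<^sup>2)
           / energy_norm a \<phi>))"

text \<open>Division is taken in the extended nonnegative reals, where \<open>1 / \<infinity> = 0\<close>.\<close>

definition c_rbe ::
    "('v::ab_group_add \<Rightarrow> 'v \<Rightarrow> 'k::real_or_complex) \<Rightarrow> nat \<Rightarrow> (nat \<Rightarrow> 'v set) \<Rightarrow>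
     (nat \<Rightarrow> 'v \<Rightarrow> 'v) \<Rightarrow> 'v set \<Rightarrow> real" where
  "c_rbe a N V P W = sqrt (1 - 1 / real N * enn2real (1 / (c_pu a N V P W)\<^sup>2))"


subsection \<open>Residual based online enrichment\<close>

definition residual ::
    "('v \<Rightarrow> 'v \<Rightarrow> 'k::real_or_complex) \<Rightarrow> ('v \<Rightarrow> 'k) \<Rightarrow> 'v \<Rightarrow> 'v \<Rightarrow> 'k" where
  "residual a f w = (\<lambda>\<phi>. f \<phi> - a w \<phi>)"

text \<open>The sequences are some run of the algorithm: \<open>Vt n\<close>, \<open>ut n\<close>, \<open>k n\<close>, \<open>uh n\<close> are the reduced
  space, the reduced solution, the chosen index and the enrichment in step \<open>n\<close>.\<close>

definition online_enrichment ::
    "('k::real_or_complex \<Rightarrow> 'v::ab_group_add \<Rightarrow> 'v) \<Rightarrow> ('v \<Rightarrow> 'v \<Rightarrow> 'k) \<Rightarrow> ('v \<Rightarrow> 'k) \<Rightarrow>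
     nat \<Rightarrow> (nat \<Rightarrow> 'v set) \<Rightarrow>
     (nat \<Rightarrow> 'v set) \<Rightarrow> (nat \<Rightarrow> 'v) \<Rightarrow> (nat \<Rightarrow> nat) \<Rightarrow> (nat \<Rightarrow> 'v) \<Rightarrow> bool" where
  "online_enrichment smul a f N V Vt ut k uh \<longleftrightarrow>
     Vt 0 = {0} \<and>
     (\<forall>n. ut n \<in> Vt n \<and> (\<forall>\<phi>\<in>Vt n. a (ut n) \<phi> = f \<phi>) \<and>
          is_arg_max (\<lambda>i. dual_norm a (V i) (residual a f (ut n))) (\<lambda>i. i \<in> {1..N}) (k n) \<and>
          uh n \<in> V (k n) \<and> (\<forall>\<phi>\<in>V (k n). a (uh n) \<phi> = residual a f (ut n) \<phi>) \<and>
          Vt (Suc n) = {v + w | v w. v \<in> Vt n \<and> w \<in> module.span smul {uh n}})"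

end

theory Submission
  imports Defs
begin

text \<open>
  Write \<open>e = u - ut n\<close>, so that the residual is \<open>a(e, \<cdot>)\<close> and vanishes on \<open>W = Vt n\<close>, and let
  \<open>r\<close> be the energy norm of the enrichment \<open>uh n\<close>. Since \<open>uh n\<close> represents the residual on the
  chosen local space, \<open>r\<close> bounds the dual norm of the residual on that space, and by the choice of
  the index, it bounds the dual norms on all the local spaces.

  The error decreases by at least the contribution of the enrichment: by Galerkin optimality, the
  new error is no larger than that of \<open>ut n + uh n\<close>, whose square is \<open>\<parallel>e\<parallel>\<^sup>2 - r\<^sup>2\<close>
  (\<open>galerkin_enrichment\<close>). And the enrichment is not small: the residual annihilates \<open>W \<inter> V i\<close>, so
  splitting \<open>e = (\<Sum>i. P i e)\<close> and removing the projection of each summand onto \<open>W \<inter> V i\<close> gives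
  \<open>\<parallel>e\<parallel>\<^sup>2 = (\<Sum>i. a(e, (1 - proj\<^sub>i) P i e)) \<le> r (\<Sum>i. \<parallel>(1 - proj\<^sub>i) P i e\<parallel>) \<le> r \<surd>N c \<parallel>e\<parallel>\<close> with
  \<open>c\<close> the stability constant of the decomposition (\<open>residual_lower_bound\<close>). Combining both bounds
  yields the contraction factor. The projections exist because \<open>W\<close> is finite dimensional.
\<close>

section \<open>Conjugation and real part\<close>

text \<open>At a nonzero real \<open>r\<close>, the axiom \<open>r * conj r = r\<^sup>2\<close> can be cancelled.\<close>

lemma conj_of_real: "conj (of_real r :: 'k::real_or_complex) = of_real r"
proof (cases "r = 0")
  case True
  have "conj (0::'k) + conj 0 = conj 0"
    by (metis add_0 conj_add)
  then show ?thesis using True by simp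
next
  case False
  have "(of_real r :: 'k) * conj (of_real r) = of_real r * of_real r"
    using mult_conj[of "of_real r :: 'k"] by (simp add: of_real_def power2_eq_square)
  then show ?thesis using False by simp
qed

lemma norm_conj: "norm (conj x) = norm (x :: 'k::real_or_complex)"
proof (cases "x = 0")
  case True
  then show ?thesis using conj_of_real[of 0, where ?'k='k] by simp
next
  case False
  have "norm x * norm (conj x) = norm x * norm x"
    by (metis mult_conj norm_mult norm_of_real of_real_def abs_of_nonneg zero_le_power2
        power2_eq_square)
  then show ?thesis using False by simp
qed

lemma of_real_re: "of_real (re x) = (x + conj x) / (2 :: 'k::real_or_complex)"
  by (simp add: of_real_def scaleR_re)

lemma re_add: "re (x + y :: 'k::real_or_complex) = re x + re y"
proof -
  have "(of_real (re (x + y)) :: 'k) = of_real (re x + re y)"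
    by (simp add: of_real_re conj_add add_divide_distrib)
  then show ?thesis by (simp only: of_real_eq_iff)
qed

lemma re_of_real: "re (of_real r :: 'k::real_or_complex) = r"
proof -
  have "(of_real (re (of_real r :: 'k)) :: 'k) = of_real r"
    by (simp add: of_real_re conj_of_real)
  then show ?thesis by (simp only: of_real_eq_iff)
qed

lemma re_le_norm: "re x \<le> norm (x :: 'k::real_or_complex)"
proof -
  have "\<bar>re x\<bar> = norm ((x + conj x) / 2)"
    by (metis of_real_re norm_of_real)
  also have "\<dots> \<le> (norm x + norm (conj x)) / 2"
    using norm_triangle_ineq[of x "conj x"] by (simp add: norm_divide)
  finally show ?thesis by (simp add: norm_conj)
qed


section \<open>Geometry of the energy inner product\<close>

text \<open>A vector space with a positive definite Hermitian form; completeness is not needed.\<close>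

locale energy_space = vector_space smul
  for smul :: "'k::real_or_complex \<Rightarrow> 'v::ab_group_add \<Rightarrow> 'v" +
  fixes a :: "'v \<Rightarrow> 'v \<Rightarrow> 'k"
  assumes herm: "hermitian_form smul a"
    and pos: "x \<noteq> 0 \<Longrightarrow> 0 < re (a x x)"
begin

lemma linear_form: "Vector_Spaces.linear smul (*) (a x)"
  using herm unfolding hermitian_form_def by blast

lemma form_commute: "a y x = conj (a x y)"
  using herm unfolding hermitian_form_def by blast

lemma form_add_right: "a x (y + z) = a x y + a x z"
  by (rule module_hom.add[OF Vector_Spaces.linear.axioms(3)[OF linear_form]])

lemma form_scale_right: "a x (smul c y) = c * a x y"
  by (rule module_hom.scale[OF Vector_Spaces.linear.axioms(3)[OF linear_form]])

lemma form_diff_right: "a x (y - z) = a x y - a x z"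
  using form_add_right[of x "y - z" z] by simp

lemma form_sum_right: "finite I \<Longrightarrow> a x (\<Sum>i\<in>I. g i) = (\<Sum>i\<in>I. a x (g i))"
proof (induction I rule: finite_induct)
  case empty
  show ?case using form_diff_right[of x 0 0] by simp
qed (simp add: form_add_right)

lemma form_zero_right: "a x 0 = 0"
  using form_diff_right[of x 0 0] by simp

lemma form_add_left: "a (x + y) z = a x z + a y z"
  by (metis form_commute form_add_right conj_add)

lemma form_scale_left: "a (smul c x) y = conj c * a x y"
  by (metis form_commute form_scale_right conj_mult)

lemma form_diff_left: "a (x - y) z = a x z - a y z"
  using form_add_left[of "x - y" y z] by simp

lemma form_zero_left: "a 0 x = 0"
  using form_diff_left[of 0 0 x] by simp

lemma orthogonal_commute: "a x y = 0 \<Longrightarrow> a y x = 0"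
  using form_commute[of y x] conj_of_real[of 0, where ?'k='k] by simp

lemma re_form_nonneg: "0 \<le> re (a x x)"
  using pos[of x] re_of_real[of 0, where ?'k='k]
  by (cases "x = 0") (auto simp: form_zero_left)

lemma energy_norm_nonneg: "0 \<le> energy_norm a x"
  by (simp add: energy_norm_def re_form_nonneg)

lemma energy_norm_pos: "x \<noteq> 0 \<Longrightarrow> 0 < energy_norm a x"
  by (simp add: energy_norm_def pos)

lemma energy_norm_sq: "(energy_norm a x)\<^sup>2 = re (a x x)"
  by (simp add: energy_norm_def re_form_nonneg)

lemma form_self: "a x x = of_real ((energy_norm a x)\<^sup>2)"
proof -
  have "of_real (re (a x x)) = (a x x + a x x) / 2"
    using form_commute[of x x] by (simp only: of_real_re)
  then show ?thesis by (simp add: energy_norm_sq)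
qed

lemma pythagoras:
  assumes "a x y = 0"
  shows "(energy_norm a (x + y))\<^sup>2 = (energy_norm a x)\<^sup>2 + (energy_norm a y)\<^sup>2"
  using assms orthogonal_commute[OF assms]
  by (simp add: energy_norm_sq form_add_left form_add_right re_add)

lemma energy_norm_scale: "energy_norm a (smul c x) = norm c * energy_norm a x"
proof -
  have "a (smul c x) (smul c x) = c * conj c * a x x"
    by (simp add: form_scale_left form_scale_right mult_ac)
  also have "\<dots> = of_real ((norm c)\<^sup>2 * (energy_norm a x)\<^sup>2)"
    by (simp add: mult_conj form_self of_real_def)
  finally have "(energy_norm a (smul c x))\<^sup>2 = (norm c * energy_norm a x)\<^sup>2"
    by (simp only: energy_norm_sq[of "smul c x"] re_of_real power_mult_distrib)
  then show ?thesis by (simp add: energy_norm_nonneg)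
qed

lemma cauchy_schwarz: "norm (a x y) \<le> energy_norm a x * energy_norm a y"
proof (cases "x = 0")
  case True
  then show ?thesis by (simp add: form_zero_left energy_norm_nonneg)
next
  case False
  note q = energy_norm_pos[OF False]
  let ?q = "(energy_norm a x)\<^sup>2"
  define c where "c = a x y / of_real ?q"
  have "a x (y - smul c x) = 0"
    using q by (simp add: form_diff_right form_scale_right form_self c_def)
  then have "a (smul c x) (y - smul c x) = 0"
    by (simp add: form_scale_left)
  from pythagoras[OF this] have "(energy_norm a (smul c x))\<^sup>2 \<le> (energy_norm a y)\<^sup>2"
    by simp
  then have "norm c * energy_norm a x \<le> energy_norm a y"
    using power2_le_imp_le energy_norm_nonneg by (simp only: energy_norm_scale) blast
  from mult_left_mono[OF this, of "energy_norm a x"]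
  have "norm c * ?q \<le> energy_norm a x * energy_norm a y"
    using q by (simp add: power2_eq_square mult_ac)
  moreover have "norm c * ?q = norm (a x y)"
    using q by (simp add: c_def norm_divide del: of_real_power)
  ultimately show ?thesis by simp
qed

text \<open>One Gram-Schmidt step per spanning vector.\<close>

lemma orthogonal_projection_span:
  assumes "finite B"
  shows "\<exists>p\<in>span B. \<forall>w\<in>span B. a w (x - p) = 0"
  using assms
proof (induction B arbitrary: x rule: finite_induct)
  case empty
  show ?case by (simp add: form_zero_left)
next
  case (insert b B)
  obtain p where p: "p \<in> span B" "\<And>w. w \<in> span B \<Longrightarrow> a w (x - p) = 0"
    using insert.IH by blast
  obtain q where q: "q \<in> span B" "\<And>w. w \<in> span B \<Longrightarrow> a w (b - q) = 0"
    using insert.IH by blast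
  define z where "z = b - q"
  define c where "c = a z (x - p) / of_real ((energy_norm a z)\<^sup>2)"
  have c: "c * a z z = a z (x - p)"
    using energy_norm_pos[of z]
    by (cases "z = 0") (auto simp: c_def form_self form_zero_left)
  have sub: "span B \<subseteq> span (insert b B)" by (rule span_mono) auto
  have z: "z \<in> span (insert b B)"
    unfolding z_def using q(1) sub by (auto intro: span_diff span_base)
  have "a w (x - (p + smul c z)) = 0" if w: "w \<in> span (insert b B)" for w
  proof -
    obtain d where "w - smul d b \<in> span B" using w span_breakdown_eq by blast
    then have "(w - smul d b) + smul d q \<in> span B" using q(1) by (intro span_add span_scale)
    moreover define v where "v = (w - smul d b) + smul d q"
    ultimately have v: "v \<in> span B" by simp
    have w_eq: "w = v + smul d z"
      by (simp add: v_def z_def scale_right_diff_distrib)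
    have split: "x - (p + smul c z) = (x - p) - smul c z" by simp
    have "a v (x - (p + smul c z)) = 0"
      using p(2)[OF v] q(2)[OF v]
      by (simp add: split form_diff_right form_scale_right z_def[symmetric])
    moreover have "a z (x - (p + smul c z)) = 0"
      using c by (simp add: split form_diff_right form_scale_right)
    ultimately show ?thesis by (simp add: w_eq form_add_left form_scale_left)
  qed
  moreover have "p + smul c z \<in> span (insert b B)"
    using p(1) sub z by (auto intro: span_add span_scale)
  ultimately show ?case by blast
qed

lemma energy_projection:
  assumes U: "subspace U" and "finite B" "U \<subseteq> span B"
  shows "energy_projection a U x \<in> U" "\<forall>w\<in>U. a w (x - energy_projection a U x) = 0"
proof -
  obtain C where C: "C \<subseteq> U" "independent C" "U \<subseteq> span C"
    using basis_exists[of U] by metis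
  have "finite C"
    using independent_span_bound[of B C] C assms by blast
  moreover have span: "span C = U"
    using C U by (meson span_minimal subset_antisym)
  ultimately obtain p where p: "p \<in> U" "\<forall>w\<in>U. a w (x - p) = 0"
    using orthogonal_projection_span[of C x] by auto
  have "p' = p" if p': "p' \<in> U" "\<forall>w\<in>U. a w (x - p') = 0" for p'
  proof -
    have mem: "p' - p \<in> U" using U p'(1) p(1) by (rule subspace_diff)
    have "p' - p = (x - p) - (x - p')" by simp
    then have "a (p' - p) (p' - p) = a (p' - p) (x - p) - a (p' - p) (x - p')"
      by (metis form_diff_right)
    also have "\<dots> = 0" using p(2) p'(2) mem by simp
    finally show ?thesis
      using pos[of "p' - p"] re_of_real[of 0, where ?'k='k] by fastforce
  qed
  then have "energy_projection a U x = p"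
    unfolding energy_projection_def using p by (intro the_equality) blast+
  then show "energy_projection a U x \<in> U" "\<forall>w\<in>U. a w (x - energy_projection a U x) = 0"
    using p by simp_all
qed


section \<open>The two estimates\<close>

lemma galerkin_optimal:
  assumes "subspace U" "x \<in> U" "y \<in> U" "\<forall>\<phi>\<in>U. a (u - x) \<phi> = 0"
  shows "(energy_norm a (u - x))\<^sup>2 \<le> (energy_norm a (u - y))\<^sup>2"
proof -
  have "a (u - x) (x - y) = 0" using assms subspace_diff by blast
  from pythagoras[OF this] show ?thesis by simp
qed

lemma galerkin_enrichment:
  assumes "subspace U" "x \<in> U" "\<forall>\<phi>\<in>U. a (u - x) \<phi> = 0"
    and "y + h \<in> U" "a h h = a (u - y) h"
  shows "(energy_norm a (u - x))\<^sup>2 \<le> (energy_norm a (u - y))\<^sup>2 - (energy_norm a h)\<^sup>2"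
proof -
  have "a (u - y - h) h = 0" using assms(5) by (simp add: form_diff_left)
  from pythagoras[OF this]
  have "(energy_norm a (u - (y + h)))\<^sup>2 = (energy_norm a (u - y))\<^sup>2 - (energy_norm a h)\<^sup>2"
    by (simp add: diff_diff_eq)
  then show ?thesis using galerkin_optimal[OF assms(1,2,4,3)] by simp
qed

lemma norm_le_dual_norm:
  assumes "dual_norm a U F \<le> ennreal r" "0 \<le> r" "\<phi> \<in> U" "F 0 = 0"
  shows "norm (F \<phi>) \<le> r * energy_norm a \<phi>"
proof (cases "\<phi> = 0")
  case True
  then show ?thesis using assms energy_norm_nonneg by simp
next
  case False
  have "ennreal (norm (F \<phi>) / energy_norm a \<phi>) \<le> dual_norm a U F"
    unfolding dual_norm_def using False assms(3) by (intro SUP_upper) auto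
  then have "norm (F \<phi>) / energy_norm a \<phi> \<le> r"
    using assms(1,2) ennreal_le_iff order_trans by blast
  then show ?thesis using energy_norm_pos[OF False] by (simp add: pos_divide_le_eq)
qed

lemma dual_norm_le:
  assumes "0 \<le> r" "\<And>\<phi>. \<phi> \<in> U \<Longrightarrow> norm (F \<phi>) \<le> r * energy_norm a \<phi>"
  shows "dual_norm a U F \<le> ennreal r"
  unfolding dual_norm_def
proof (rule SUP_least)
  fix \<phi> assume "\<phi> \<in> U - {0}"
  then show "ennreal (norm (F \<phi>) / energy_norm a \<phi>) \<le> ennreal r"
    using assms energy_norm_pos[of \<phi>] by (simp add: ennreal_leI pos_divide_le_eq)
qed

lemma projection_defect_le_c_pu:
  assumes "c_pu a N V P W = ennreal c" "0 \<le> c" "\<phi> \<noteq> 0"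
  shows "sqrt (\<Sum>i = 1..N.
      (energy_norm a (P i \<phi> - energy_projection a (W \<inter> V i) (P i \<phi>)))\<^sup>2) \<le> c * energy_norm a \<phi>"
    (is "?d \<le> _")
proof -
  have "ennreal (?d / energy_norm a \<phi>) \<le> c_pu a N V P W"
    unfolding c_pu_def using assms(3) by (intro SUP_upper) auto
  then have "?d / energy_norm a \<phi> \<le> c"
    using assms by (simp add: ennreal_le_iff)
  then show ?thesis using energy_norm_pos[OF assms(3)] by (simp add: pos_divide_le_eq)
qed

text \<open>A functional \<open>a(e, \<cdot>)\<close> that vanishes on \<open>W\<close> cannot be small on all the local spaces.\<close>

lemma residual_lower_bound:
  assumes e: "e \<noteq> 0" "\<forall>w\<in>W. a e w = 0"
    and W: "subspace W" "finite B" "W \<subseteq> span B"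
    and V: "\<And>i. i \<in> {1..N} \<Longrightarrow> subspace (V i)"
    and P: "\<And>i. i \<in> {1..N} \<Longrightarrow> P i e \<in> V i" "(\<Sum>i = 1..N. P i e) = e"
    and r: "\<And>i \<phi>. i \<in> {1..N} \<Longrightarrow> \<phi> \<in> V i \<Longrightarrow> norm (a e \<phi>) \<le> r * energy_norm a \<phi>" "0 \<le> r"
    and c: "c_pu a N V P W = ennreal c" "0 \<le> c"
  shows "energy_norm a e \<le> r * sqrt (real N) * c"
proof -
  define d where "d = (\<lambda>i. P i e - energy_projection a (W \<inter> V i) (P i e))"
  have d: "d i \<in> V i" "a e (d i) = a e (P i e)" if i: "i \<in> {1..N}" for i
  proof -
    have "subspace (W \<inter> V i)" using W(1) V[OF i] by (rule subspace_inter)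
    from energy_projection(1)[OF this W(2)] W(3)
    have mem: "energy_projection a (W \<inter> V i) (P i e) \<in> W \<inter> V i" by blast
    then show "d i \<in> V i" unfolding d_def using V P(1) i subspace_diff by blast
    show "a e (d i) = a e (P i e)" using mem e(2) by (simp add: d_def form_diff_right)
  qed
  have "a e e = a e (\<Sum>i = 1..N. P i e)" by (simp only: P(2))
  also have "\<dots> = (\<Sum>i = 1..N. a e (d i))" using d(2) by (simp add: form_sum_right)
  finally have "(energy_norm a e)\<^sup>2 \<le> norm (\<Sum>i = 1..N. a e (d i))"
    using re_le_norm[of "a e e"] by (simp add: energy_norm_sq)
  also have "\<dots> \<le> (\<Sum>i = 1..N. r * energy_norm a (d i))"
    using r(1) d(1) by (intro sum_norm_le) auto
  also have "\<dots> = r * (\<Sum>i = 1..N. 1 * energy_norm a (d i))"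
    by (simp add: sum_distrib_left)
  also have "\<dots> \<le> r * (sqrt (real N) * L2_set (\<lambda>i. energy_norm a (d i)) {1..N})"
    using L2_set_mult_ineq[of "\<lambda>_. 1" "\<lambda>i. energy_norm a (d i)" "{1..N}"] r(2) energy_norm_nonneg
    by (intro mult_left_mono) (simp_all add: L2_set_def)
  also have "\<dots> \<le> r * (sqrt (real N) * (c * energy_norm a e))"
    using projection_defect_le_c_pu[OF c e(1)] r(2)
    by (intro mult_left_mono) (simp_all add: L2_set_def d_def)
  finally have "energy_norm a e * energy_norm a e \<le> (r * sqrt (real N) * c) * energy_norm a e"
    by (simp add: power2_eq_square mult_ac)
  then show ?thesis using energy_norm_pos[OF e(1)] by simp
qed

end


section \<open>The enriched spaces\<close>

lemma online_enrichment_span: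
  assumes "vector_space smul" "online_enrichment smul a f N V Vt ut k uh"
  shows "Vt n = module.span smul (uh ` {..<n})"
proof (induction n)
  interpret vector_space smul by fact
  case 0
  show ?case using assms(2) by (simp add: online_enrichment_def)
next
  interpret vector_space smul by fact
  case (Suc n)
  have "Vt (Suc n) = {v + w | v w. v \<in> Vt n \<and> w \<in> span {uh n}}"
    using assms(2) by (simp add: online_enrichment_def)
  also have "\<dots> = span (uh ` {..<n} \<union> {uh n})"
    unfolding span_Un Suc.IH by blast
  finally show ?case by (simp add: lessThan_Suc)
qed


section \<open>Contraction of the energy error\<close>

theorem theorem6p3p1:
  fixes smul :: "'k::real_or_complex \<Rightarrow> 'v::banach \<Rightarrow> 'v"
    and ip a :: "'v \<Rightarrow> 'v \<Rightarrow> 'k"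
    and \<Omega> :: "(real ^ 'd) set"
    and fn :: "'v \<Rightarrow> real ^ 'd \<Rightarrow> 'k"
    and N :: nat
    and \<omega> :: "nat \<Rightarrow> (real ^ 'd) set"
    and V :: "nat \<Rightarrow> 'v set"
    and P :: "nat \<Rightarrow> 'v \<Rightarrow> 'v"
    and f :: "'v \<Rightarrow> 'k"
    and u :: 'v
    and Vt :: "nat \<Rightarrow> 'v set"
    and ut uh :: "nat \<Rightarrow> 'v"
    and k :: "nat \<Rightarrow> nat"
    and n :: nat
  assumes "localizing_space_decomposition smul ip \<Omega> fn N \<omega> V P"
    and "hermitian_form smul a"
    and "continuous_form a"
    and "coercive_form a"
    and "Vector_Spaces.linear smul (*) f"
    and "continuous_on UNIV f"
    and "\<forall>v. a u v = f v"
    and "online_enrichment smul a f N V Vt ut k uh"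
    and "ut n \<noteq> u"
  shows "energy_norm a (u - ut (Suc n))
           \<le> c_rbe a N V P (Vt n) * energy_norm a (u - ut n)"
proof -
  interpret D: localizing_space_decomposition smul ip \<Omega> fn N \<omega> V P by fact
  obtain \<alpha> where \<alpha>: "0 < \<alpha>" "\<And>x. \<alpha> * (norm x)\<^sup>2 \<le> re (a x x)"
    using assms(4) by (auto simp: coercive_form_def)
  interpret E: energy_space smul a
  proof unfold_locales
    show "0 < re (a x x)" if "x \<noteq> 0" for x
    proof -
      have "0 < \<alpha> * (norm x)\<^sup>2" using \<alpha>(1) that by simp
      then show ?thesis using \<alpha>(2)[of x] by linarith
    qed
  qed fact
  note run = assms(8)[unfolded online_enrichment_def]
  note f = assms(7)[rule_format, symmetric]

  define e where "e = u - ut n"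
  define r where "r = energy_norm a (uh n)"
  have e: "e \<noteq> 0" using assms(9) by (simp add: e_def)
  have r: "0 \<le> r" by (simp add: r_def E.energy_norm_nonneg)
  have res: "residual a f (ut n) = a e"
    by (simp add: fun_eq_iff residual_def e_def E.form_diff_left f)
  have Vt: "Vt m = D.span (uh ` {..<m})" for m
    by (rule online_enrichment_span[OF D.vector_space_axioms assms(8)])
  have sub: "D.subspace (Vt m)" for m by (simp add: Vt)
  have orth: "\<forall>\<phi>\<in>Vt m. a (u - ut m) \<phi> = 0" for m
    using run by (simp add: E.form_diff_left f)
  have kn: "k n \<in> {1..N}"
    and kmax: "\<And>i. i \<in> {1..N} \<Longrightarrow> dual_norm a (V i) (a e) \<le> dual_norm a (V (k n)) (a e)"
    using run[THEN conjunct2, rule_format, of n] unfolding is_arg_max_def res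
    by (auto simp: not_less)
  have uh: "uh n \<in> V (k n)" "\<And>\<phi>. \<phi> \<in> V (k n) \<Longrightarrow> a (uh n) \<phi> = a e \<phi>"
    using run[THEN conjunct2, rule_format, of n] unfolding res by auto

  have bounded: "norm (a e \<phi>) \<le> r * energy_norm a \<phi>" if "i \<in> {1..N}" "\<phi> \<in> V i" for i \<phi>
  proof -
    have "dual_norm a (V (k n)) (a e) \<le> ennreal r"
    proof (rule E.dual_norm_le[OF r])
      fix \<psi> assume "\<psi> \<in> V (k n)"
      then show "norm (a e \<psi>) \<le> r * energy_norm a \<psi>"
        using E.cauchy_schwarz[of "uh n" \<psi>] uh(2)[of \<psi>] by (simp add: r_def)
    qed
    then have "dual_norm a (V i) (a e) \<le> ennreal r" using kmax[OF that(1)] by simp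
    then show ?thesis using r that(2) E.form_zero_right by (rule E.norm_le_dual_norm)
  qed

  have decay: "(energy_norm a (u - ut (Suc n)))\<^sup>2 \<le> (energy_norm a e)\<^sup>2 - r\<^sup>2"
    unfolding e_def r_def
  proof (rule E.galerkin_enrichment[OF sub _ orth])
    show "ut (Suc n) \<in> Vt (Suc n)" using run by blast
    show "ut n + uh n \<in> Vt (Suc n)" using run by (auto intro!: exI D.span_base)
    show "a (uh n) (uh n) = a (u - ut n) (uh n)" using uh by (simp add: e_def)
  qed

  define t where "t = enn2real (1 / (c_pu a N V P (Vt n))\<^sup>2)"
  have t: "1 / real N * t * (energy_norm a e)\<^sup>2 \<le> r\<^sup>2"
  proof (cases "c_pu a N V P (Vt n)")
    case (real c)
    have bound: "energy_norm a e \<le> r * sqrt (real N) * c"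
    proof (rule E.residual_lower_bound[where W = "Vt n" and B = "uh ` {..<n}" and V = V and P = P])
      show "\<forall>w\<in>Vt n. a e w = 0" using orth by (simp add: e_def)
    qed (use e sub real bounded r D.local_subspace D.P_range D.P_sum Vt in auto)
    \<comment> \<open>Since \<open>e \<noteq> 0\<close>, the bound excludes \<open>c = 0\<close>, where the reciprocal would be infinite.\<close>
    then have "c \<noteq> 0" using E.energy_norm_pos[OF e] by auto
    then have c: "0 < c" using real by simp
    have N: "0 < real N" using kn by simp
    have "t = 1 / c\<^sup>2"
      using c by (simp add: t_def real ennreal_power divide_ennreal flip: ennreal_1)
    moreover have "(energy_norm a e)\<^sup>2 \<le> r\<^sup>2 * (real N * c\<^sup>2)"
      using power_mono[OF bound E.energy_norm_nonneg, of 2] by (simp add: power_mult_distrib mult_ac)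
    moreover have "0 < real N * c\<^sup>2" using c N by simp
    ultimately show ?thesis by (simp add: pos_divide_le_eq)
  next
    case top
    \<comment> \<open>Here \<open>t = 0\<close>: only monotonicity of the error is claimed.\<close>
    then show ?thesis by (simp add: t_def)
  qed

  have "(energy_norm a (u - ut (Suc n)))\<^sup>2 \<le> (1 - 1 / real N * t) * (energy_norm a e)\<^sup>2"
    using decay t by (simp add: left_diff_distrib)
  then have "energy_norm a (u - ut (Suc n)) \<le> sqrt ((1 - 1 / real N * t) * (energy_norm a e)\<^sup>2)"
    by (rule real_le_rsqrt)
  also have "\<dots> = c_rbe a N V P (Vt n) * energy_norm a e"
    using E.energy_norm_nonneg[of e] by (simp add: c_rbe_def t_def real_sqrt_mult)
  finally show ?thesis by (simp add: e_def)
qed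

end
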